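(* Consider the relay feedback system $$\dot x=Ax-b\,\mathrm{sgn}(y),\qquad y=c^Tx,$$ where $A\in\mathbb{R}^{n\times n}$ and $b,c\in\mathbb{R}^n$. Let $U\subseteq\mathbb{R}^n$ be the (open) state space and $\mathcal{C}\subseteq U$ a forward-invariant $K$-reachable set. If there exist a norm, with associated matrix measure $\mu$, and a positive constant $\bar c$ such that $$\mu(A)\le-\bar c,\qquad \mu(-b\,c^T)=0,$$ then the relay feedback system is incrementally exponentially stable in $\mathcal{C}$ with convergence rate $\bar c$.
   Context: The system equals $\dot x=Ax-b$ if $c^Tx>0$ and $\dot x=Ax+b$ if $c^Tx<0$, with $c\neq0$ and switching manifold $\Sigma=\{x\in U:c^Tx=0\}$. Standing assumption: solutions are understood in the sense of Filippov (where $c^T(Ax-b)<0<c^T(Ax+b)$ on $\Sigma$, the motion follows the convex combination of the two vector fields that is tangent to $\Sigma$), and right uniqueness of solutions holds in $U$. Matrix measure: for a norm $|\cdot|$ on $\mathbb{R}^n$ with induced matrix norm $\|\cdot\|$, $\mu(M)=\lim_{h\to0^+}\frac{\|I+hM\|-1}{h}$. $K$-reachable: $\mathcal{C}\subseteq\mathbb{R}^n$ is $K$-reachable ($K>0$) if for any $x_0,y_0\in\mathcal{C}$ there is a continuously differentiable curve $\gamma:[0,1]\to\mathcal{C}$ with $\gamma(0)=x_0$, $\gamma(1)=y_0$, $|\gamma'(r)|\le K|y_0-x_0|$ for all $r$. Forward invariant: solutions starting in $\mathcal{C}$ at time $t_0$ stay in $\mathcal{C}$ for all $t\ge t_0$.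 Incrementally exponentially stable in the forward-invariant set $\mathcal{C}$ with convergence rate $\bar c>0$: there is a constant $K\ge1$ such that any two solutions $x(t),z(t)$ with $x(t_0)=x_0\in\mathcal{C}$, $z(t_0)=z_0\in\mathcal{C}$ satisfy $|x(t)-z(t)|\le K e^{-\bar c(t-t_0)}|x_0-z_0|$ for all $t\ge t_0$, in the given norm. *)

theory Defs
  imports "HOL-Analysis.Analysis"
begin

text \<open>
  The norm is a parameter of the theory (an arbitrary norm on \<open>\<real>\<^sup>n\<close>, not only the Euclidean
  one), so it is a function satisfying the norm axioms rather than the type-class norm.
\<close>

definition is_norm :: "('a::real_vector \<Rightarrow> real) \<Rightarrow> bool" where
  "is_norm N \<longleftrightarrow>
     (\<forall>x. 0 \<le> N x) \<and> (\<forall>x. N x = 0 \<longleftrightarrow> x = 0) \<and>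
     (\<forall>a x. N (a *\<^sub>R x) = \<bar>a\<bar> * N x) \<and> (\<forall>x y. N (x + y) \<le> N x + N y)"

definition induced_norm :: "(real^'n \<Rightarrow> real) \<Rightarrow> real^'n^'n \<Rightarrow> real" where
  "induced_norm N M = (SUP x\<in>{x. N x = 1}. N (M *v x))"

definition matrix_measure :: "(real^'n \<Rightarrow> real) \<Rightarrow> real^'n^'n \<Rightarrow> real" where
  "matrix_measure N M = Lim (at_right 0) (\<lambda>h. (induced_norm N (mat 1 + h *\<^sub>R M) - 1) / h)"

definition outer_prod :: "real^'n \<Rightarrow> real^'n \<Rightarrow> real^'n^'n" where
  "outer_prod b c = (\<chi> i j. b $ i * c $ j)"

definition K_reachable :: "(real^'n \<Rightarrow> real) \<Rightarrow> real \<Rightarrow> (real^'n) set \<Rightarrow> bool" where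
  "K_reachable N K C \<longleftrightarrow> K > 0 \<and>
     (\<forall>x0\<in>C. \<forall>y0\<in>C. \<exists>\<gamma> \<gamma>'.
        (\<forall>r\<in>{0..1}. \<gamma> r \<in> C \<and> (\<gamma> has_vector_derivative \<gamma>' r) (at r within {0..1})) \<and>
        continuous_on {0..1} \<gamma>' \<and> \<gamma> 0 = x0 \<and> \<gamma> 1 = y0 \<and>
        (\<forall>r\<in>{0..1}. N (\<gamma>' r) \<le> K * N (y0 - x0)))"

text \<open>
  Filippov's set-valued extension of a vector field on \<open>U\<close>: the values of the field on null
  sets are disregarded.  For a field that is smooth on either side of a hyperplane, its value
  on the hyperplane is the segment joining the two one-sided limits, so that a solution
  staying in the hyperplane moves with the tangent convex combination of the two fields.
\<close>

definition filippov_map ::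
  "'a::euclidean_space set \<Rightarrow> ('a \<Rightarrow> 'a) \<Rightarrow> 'a \<Rightarrow> 'a set" where
  "filippov_map U f x =
     (\<Inter>\<delta>\<in>{0<..}. \<Inter>Z\<in>{Z. negligible Z}. closure (convex hull (f ` (ball x \<delta> \<inter> U - Z))))"

definition absolutely_continuous_on_Icc ::
  "(real \<Rightarrow> 'a::real_normed_vector) \<Rightarrow> real \<Rightarrow> real \<Rightarrow> bool" where
  "absolutely_continuous_on_Icc x a b \<longleftrightarrow>
     (\<forall>\<epsilon>>0. \<exists>\<delta>>0. \<forall>D. finite D \<longrightarrow>
        (\<forall>(u, v)\<in>D. a \<le> u \<and> u \<le> v \<and> v \<le> b) \<longrightarrow>
        pairwise (\<lambda>p q. disjnt {fst p<..<snd p} {fst q<..<snd q}) D \<longrightarrow>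
        (\<Sum>(u, v)\<in>D. v - u) < \<delta> \<longrightarrow> (\<Sum>(u, v)\<in>D. norm (x v - x u)) < \<epsilon>)"

text \<open>Time domains \<open>[t0, T]\<close>, \<open>[t0, T)\<close> and \<open>[t0, \<infinity>)\<close>.\<close>

definition forward_interval :: "real \<Rightarrow> real set \<Rightarrow> bool" where
  "forward_interval t0 J \<longleftrightarrow> is_interval J \<and> t0 \<in> J \<and> (\<forall>t\<in>J. t0 \<le> t)"

definition filippov_solution ::
  "'a::euclidean_space set \<Rightarrow> ('a \<Rightarrow> 'a) \<Rightarrow> real set \<Rightarrow> (real \<Rightarrow> 'a) \<Rightarrow> bool" where
  "filippov_solution U f J x \<longleftrightarrow>
     (\<forall>t\<in>J. x t \<in> U) \<and>
     (\<forall>a\<in>J. \<forall>b\<in>J. absolutely_continuous_on_Icc x a b) \<and>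
     (AE t in lebesgue. t \<in> J \<longrightarrow>
        (\<exists>v\<in>filippov_map U f (x t). (x has_vector_derivative v) (at t within J)))"

definition right_unique_solutions :: "'a::euclidean_space set \<Rightarrow> ('a \<Rightarrow> 'a) \<Rightarrow> bool" where
  "right_unique_solutions U f \<longleftrightarrow>
     (\<forall>t0 J x z. forward_interval t0 J \<longrightarrow>
        filippov_solution U f J x \<longrightarrow> filippov_solution U f J z \<longrightarrow> x t0 = z t0 \<longrightarrow>
        (\<forall>t\<in>J. x t = z t))"

definition forward_invariant ::
  "'a::euclidean_space set \<Rightarrow> ('a \<Rightarrow> 'a) \<Rightarrow> 'a set \<Rightarrow> bool" where
  "forward_invariant U f C \<longleftrightarrow>
     (\<forall>t0 J x. forward_interval t0 J \<longrightarrow> filippov_solution U f J x \<longrightarrow> x t0 \<in> C \<longrightarrow>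
        (\<forall>t\<in>J. x t \<in> C))"

text \<open>
  The constant may not depend on the initial time, the initial states or the time domain.
  Two solutions with different time domains are compared on the intersection of the domains.
\<close>

definition incrementally_exp_stable ::
  "'a::euclidean_space set \<Rightarrow> ('a \<Rightarrow> 'a) \<Rightarrow> ('a \<Rightarrow> real) \<Rightarrow> 'a set \<Rightarrow> real \<Rightarrow> bool" where
  "incrementally_exp_stable U f N C rate \<longleftrightarrow> rate > 0 \<and>
     (\<exists>K\<ge>1. \<forall>t0 J x z. forward_interval t0 J \<longrightarrow>
        filippov_solution U f J x \<longrightarrow> filippov_solution U f J z \<longrightarrow>
        x t0 \<in> C \<longrightarrow> z t0 \<in> C \<longrightarrow>
        (\<forall>t\<in>J. N (x t - z t) \<le> K * exp (- rate * (t - t0)) * N (x t0 - z t0)))"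

definition relay_field :: "real^'n^'n \<Rightarrow> real^'n \<Rightarrow> real^'n \<Rightarrow> real^'n \<Rightarrow> real^'n" where
  "relay_field A b c x = A *v x - sgn (c \<bullet> x) *\<^sub>R b"

end

(* Let x, z be two solutions and w = x - z. Almost everywhere w' = A w - l b with l (c . w) >= 0,
   since the sign relation is monotone. The two matrix measure conditions make the relay field
   dissipative for the given norm: N (w - h w') >= (1 + cbar h) N w for every h > 0, also on the
   sliding set c . w = 0. Hence the left Dini derivative of exp (cbar t) N (w t) is at most 0
   almost everywhere, and an absolutely continuous function with this property is nonincreasing.
   The estimate therefore holds with constant 1. *)

theory Submission
  imports Defs
begin

text \<open>Off the sliding set \<open>l\<close> is k times \<open>c . w\<close> with k >= 0, so
  \<open>w\<close> solves a linear equation with matrix A - k b c^T. Subadditivity and positive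
  homogeneity of the measure bound the measure of this matrix by -cbar for every k, however large.
  Near the sliding set k is unbounded, so an estimate with an error term depending on the matrix is
  useless there. The backward inequality has no error term and sees the matrix only through its
  measure; continuity of \<open>N\<close> then carries it to the sliding set. It fits a derivative
  taken from the left, because \<open>w t - h w'\<close> approximates \<open>w (t - h)\<close>, and
  \<open>N\<close> itself is never differentiated. The remaining obstacle is the null set of times
  without derivative information: a continuous function may rise there, as the Cantor function does,
  and absolute continuity is what excludes this.\<close>

section \<open>Arbitrary norms on a Euclidean space\<close>

lemma is_norm_zero: "is_norm N \<Longrightarrow> N 0 = 0"
  and is_norm_nonneg: "is_norm N \<Longrightarrow> 0 \<le> N x"
  and is_norm_eq_0: "is_norm N \<Longrightarrow> N x = 0 \<longleftrightarrow> x = 0"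
  and is_norm_scaleR: "is_norm N \<Longrightarrow> N (a *\<^sub>R x) = \<bar>a\<bar> * N x"
  and is_norm_triangle: "is_norm N \<Longrightarrow> N (x + y) \<le> N x + N y"
  by (auto simp: is_norm_def)

lemma is_norm_minus: "is_norm N \<Longrightarrow> N (- x) = N x"
  using is_norm_scaleR[of N "-1" x] by simp

lemma is_norm_triangle_diff: "is_norm N \<Longrightarrow> N x - N y \<le> N (x - y)"
  using is_norm_triangle[of N "x - y" y] by simp

lemma is_norm_le_norm:
  fixes N :: "'a::euclidean_space \<Rightarrow> real"
  assumes "is_norm N"
  obtains L where "L > 0" "\<And>x. N x \<le> L * norm x"
proof
  let ?S = "\<Sum>i\<in>Basis. N i"
  have S: "0 \<le> ?S" by (simp add: assms is_norm_nonneg sum_nonneg)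
  then show "?S + 1 > 0" by simp
  fix x :: 'a
  have sub: "N (sum f I) \<le> (\<Sum>i\<in>I. N (f i))" if "finite I" for f :: "'a \<Rightarrow> 'a" and I
    using that
  proof induction
    case empty
    then show ?case by (simp add: assms is_norm_zero)
  next
    case (insert i I)
    then show ?case using is_norm_triangle[OF assms, of "f i" "sum f I"] by simp
  qed
  have "N x = N (\<Sum>i\<in>Basis. (x \<bullet> i) *\<^sub>R i)" by (simp add: euclidean_representation)
  also have "\<dots> \<le> (\<Sum>i\<in>Basis. N ((x \<bullet> i) *\<^sub>R i))" by (simp add: sub)
  also have "\<dots> \<le> (\<Sum>i\<in>Basis. norm x * N i)"
    by (intro sum_mono) (simp add: is_norm_scaleR[OF assms] Basis_le_norm mult_right_mono is_norm_nonneg[OF assms])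
  also have "\<dots> = norm x * ?S" by (simp add: sum_distrib_left)
  also have "\<dots> \<le> (?S + 1) * norm x" by (simp add: algebra_simps)
  finally show "N x \<le> (?S + 1) * norm x" .
qed

lemma is_norm_lipschitz:
  fixes N :: "'a::euclidean_space \<Rightarrow> real"
  assumes "is_norm N"
  obtains L where "L > 0" "\<And>x. N x \<le> L * norm x" "\<And>x y. \<bar>N x - N y\<bar> \<le> L * norm (x - y)"
proof -
  obtain L where L: "L > 0" "\<And>x. N x \<le> L * norm x" using is_norm_le_norm[OF assms] by blast
  have "\<bar>N x - N y\<bar> \<le> L * norm (x - y)" for x y
  proof -
    have "N x - N y \<le> L * norm (x - y)"
      using is_norm_triangle_diff[OF assms, of x y] L(2)[of "x - y"] by linarith
    moreover have "N y - N x \<le> L * norm (x - y)"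
      using is_norm_triangle_diff[OF assms, of y x] L(2)[of "y - x"] by (simp add: norm_minus_commute)
    ultimately show ?thesis by linarith
  qed
  with L show ?thesis using that by blast
qed

lemma is_norm_continuous_on:
  fixes N :: "'a::euclidean_space \<Rightarrow> real"
  assumes "is_norm N"
  shows "continuous_on S N"
proof -
  obtain L where L: "L > 0" "\<And>x y. \<bar>N x - N y\<bar> \<le> L * norm (x - y)"
    using is_norm_lipschitz[OF assms] by metis
  have "L-lipschitz_on S N"
    using L by (intro lipschitz_onI) (auto simp: dist_norm)
  then show ?thesis by (rule lipschitz_on_continuous_on)
qed

text \<open>The compactness half of the equivalence of norms: \<open>N\<close> attains a positive
  minimum on the Euclidean unit sphere, and its reciprocal serves as \<open>m\<close>.\<close>

lemma norm_le_is_norm: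
  fixes N :: "'a::euclidean_space \<Rightarrow> real"
  assumes "is_norm N"
  obtains m where "m > 0" "\<And>x. norm x \<le> m * N x"
proof -
  have "sphere (0::'a) 1 \<noteq> {}" by (simp)
  then obtain u where u: "u \<in> sphere (0::'a) 1" and min: "\<And>y. y \<in> sphere 0 1 \<Longrightarrow> N u \<le> N y"
    using continuous_attains_inf[OF compact_sphere _ is_norm_continuous_on[OF assms]] by metis
  have Nu: "N u > 0"
    using u is_norm_nonneg[OF assms, of u] is_norm_eq_0[OF assms, of u] by (auto simp: less_le)
  have "norm x \<le> inverse (N u) * N x" for x
  proof (cases "x = 0")
    case False
    then have "N u \<le> N (inverse (norm x) *\<^sub>R x)" by (intro min) simp
    also have "\<dots> = N x / norm x" by (simp add: is_norm_scaleR[OF assms] field_simps)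
    finally show ?thesis using False Nu by (simp add: field_simps)
  qed (simp add: is_norm_zero[OF assms])
  with Nu that show ?thesis by (metis positive_imp_inverse_positive)
qed

text \<open>Ensures that the supremum defining \<open>induced_norm\<close> is taken over a nonempty
  set, as bounds on a real supremum require.\<close>

lemma is_norm_unit_nonempty:
  fixes N :: "'a::euclidean_space \<Rightarrow> real"
  assumes "is_norm N"
  shows "{x. N x = 1} \<noteq> {}"
proof -
  obtain i :: 'a where "i \<in> Basis" using nonempty_Basis by blast
  then have "N i \<noteq> 0" using is_norm_eq_0[OF assms, of i] by auto
  then have "N (inverse (N i) *\<^sub>R i) = 1"
    using is_norm_nonneg[OF assms, of i] by (simp add: is_norm_scaleR[OF assms])
  then show ?thesis by blast
qed

section \<open>Induced norm and matrix measure\<close>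

lemma induced_norm_bound:
  assumes "is_norm N"
  shows "N (M *v x) \<le> induced_norm N M * N x"
proof (cases "x = 0")
  case False
  obtain L where L: "L > 0" "\<And>x. N x \<le> L * norm x" using is_norm_le_norm[OF assms] by blast
  obtain m where m: "m > 0" "\<And>x. norm x \<le> m * N x" using norm_le_is_norm[OF assms] by blast
  obtain B where B: "B > 0" "\<And>x. norm (M *v x) \<le> norm x * B"
    using bounded_linear.pos_bounded[OF matrix_vector_mul_bounded_linear[of M]] by blast
  \<comment> \<open>A real \<open>SUP\<close> dominates its members only for a bounded family; both
    comparisons of \<open>N\<close> with the Euclidean norm enter here.\<close>
  have bdd: "bdd_above ((\<lambda>x. N (M *v x)) ` {x. N x = 1})"
  proof (intro bdd_aboveI2)
    fix y assume "y \<in> {x. N x = 1}"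
    then have y: "norm y \<le> m" using m(2)[of y] by simp
    have "N (M *v y) \<le> L * norm (M *v y)" by (rule L)
    also have "\<dots> \<le> L * (norm y * B)" using L(1) B(2)[of y] by simp
    also have "\<dots> \<le> L * (m * B)" using L(1) B(1) y by simp
    finally show "N (M *v y) \<le> L * (m * B)" .
  qed
  have pos: "N x > 0"
    using False is_norm_nonneg[OF assms, of x] is_norm_eq_0[OF assms, of x] by linarith
  then have "N (inverse (N x) *\<^sub>R x) = 1" by (simp add: is_norm_scaleR[OF assms])
  then have "N (M *v (inverse (N x) *\<^sub>R x)) \<le> induced_norm N M"
    unfolding induced_norm_def by (intro cSUP_upper[OF _ bdd]) simp
  moreover have "N (M *v (inverse (N x) *\<^sub>R x)) = N (M *v x) / N x"
    using pos by (simp add: matrix_vector_mult_scaleR is_norm_scaleR[OF assms] field_simps)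
  ultimately show ?thesis using pos by (simp add: pos_divide_le_eq)
qed (simp add: is_norm_zero[OF assms])

lemma induced_norm_least:
  assumes "is_norm N" "\<And>x. N x = 1 \<Longrightarrow> N (M *v x) \<le> B"
  shows "induced_norm N M \<le> B"
  unfolding induced_norm_def using assms(2)
  by (intro cSUP_least is_norm_unit_nonempty[OF assms(1)]) auto

lemma mat_plus_scaleR_vector_mult:
  "(mat 1 + h *\<^sub>R M) *v x = x + h *\<^sub>R (M *v (x :: real^'n))"
  by (simp add: matrix_vector_mult_add_rdistrib scaleR_matrix_vector_assoc)

lemma is_norm_step_le:
  assumes "is_norm N"
  shows "N (x + h *\<^sub>R (M *v x)) \<le> induced_norm N (mat 1 + h *\<^sub>R M) * N (x :: real^'n)"
  using induced_norm_bound[OF assms, of "mat 1 + h *\<^sub>R M" x]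
  by (simp only: mat_plus_scaleR_vector_mult)

text \<open>The difference quotient is nondecreasing in \<open>h\<close> by convexity and bounded below, so the
  limit defining the matrix measure exists.\<close>

lemma matrix_measure_tendsto:
  fixes M :: "real^'n^'n"
  assumes N: "is_norm N"
  shows "((\<lambda>h. (induced_norm N (mat 1 + h *\<^sub>R M) - 1) / h) \<longlongrightarrow> matrix_measure N M) (at_right 0)"
proof -
  define p where "p h = induced_norm N (mat 1 + h *\<^sub>R M)" for h
  define q where "q h = (p h - 1) / h" for h
  have mono: "q s \<le> q h" if "0 < s" "s \<le> h" for s h
  proof -
    \<comment> \<open>\<open>p\<close> lies below the chord joining the value 1 at 0 to
      \<open>p h\<close> at \<open>h\<close>: the step of length \<open>s\<close> is a convex
      combination of \<open>x\<close> and the step of length \<open>h\<close>, with weight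
      \<open>s / h\<close> on the latter.\<close>
    have "p s \<le> 1 + (s / h) * (p h - 1)"
      unfolding p_def[of s]
    proof (rule induced_norm_least[OF N])
      fix x assume x: "N x = 1"
      have "(mat 1 + s *\<^sub>R M) *v x = (1 - s / h) *\<^sub>R x + (s / h) *\<^sub>R (x + h *\<^sub>R (M *v x))"
        unfolding mat_plus_scaleR_vector_mult using that by (simp add: algebra_simps)
      then have "N ((mat 1 + s *\<^sub>R M) *v x)
          \<le> N ((1 - s / h) *\<^sub>R x) + N ((s / h) *\<^sub>R (x + h *\<^sub>R (M *v x)))"
        using is_norm_triangle[OF N] by metis
      also have "\<dots> = (1 - s / h) + (s / h) * N (x + h *\<^sub>R (M *v x))"
        using that x by (simp add: is_norm_scaleR[OF N])
      also have "\<dots> \<le> (1 - s / h) + (s / h) * p h"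
        using that x is_norm_step_le[OF N, of x h M] by (simp add: p_def divide_right_mono mult_left_mono)
      finally show "N ((mat 1 + s *\<^sub>R M) *v x) \<le> 1 + (s / h) * (p h - 1)"
        by (simp add: algebra_simps)
    qed
    then show ?thesis using that by (simp add: q_def field_simps)
  qed
  have lower: "- induced_norm N M \<le> q h" if h: "0 < h" for h
  proof -
    obtain x where x: "N x = 1" using is_norm_unit_nonempty[OF N] by blast
    have "N x \<le> N (x + h *\<^sub>R (M *v x)) + N (- (h *\<^sub>R (M *v x)))"
      using is_norm_triangle[OF N, of "x + h *\<^sub>R (M *v x)" "- (h *\<^sub>R (M *v x))"] by simp
    also have "\<dots> \<le> p h + h * induced_norm N M"
      using h x is_norm_step_le[OF N, of x h M] induced_norm_bound[OF N, of M x]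
      by (simp add: is_norm_minus[OF N] is_norm_scaleR[OF N] p_def add_mono)
    finally show ?thesis using h x by (simp add: q_def field_simps)
  qed
  define l where "l = (INF h\<in>{0<..}. q h)"
  have bdd: "bdd_below (q ` {0<..})" using lower by (intro bdd_belowI2) auto
  have "(q \<longlongrightarrow> l) (at_right 0)"
  proof (rule order_tendstoI)
    fix y assume "y < l"
    moreover have "l \<le> q h" if "0 < h" for h
      unfolding l_def using that by (intro cINF_lower[OF bdd]) simp
    ultimately have "y < q h" if "0 < h" for h using that by (meson less_le_trans)
    then show "eventually (\<lambda>h. y < q h) (at_right 0)"
      by (auto simp: eventually_at_filter)
  next
    fix y assume "l < y"
    then obtain h where h: "0 < h" "q h < y"
      unfolding l_def by (auto simp: cINF_less_iff[OF _ bdd])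
    then have "q s < y" if "s \<in> {0<..<h}" for s using mono[of s h] that by auto
    then show "eventually (\<lambda>h. q h < y) (at_right 0)"
      using eventually_at_right_real[OF h(1)] by (auto elim: eventually_mono)
  qed
  moreover from this have "matrix_measure N M = l"
    unfolding matrix_measure_def q_def p_def by (intro tendsto_Lim) simp_all
  ultimately show ?thesis by (simp add: q_def[abs_def] p_def)
qed

text \<open>A step of length \<open>h\<close> along \<open>A + B\<close> is the midpoint of steps of
  length \<open>2 * h\<close> along \<open>A\<close> and along \<open>B\<close>. The doubled
  argument does not affect the limit at \<open>0\<close> from the right.\<close>

lemma matrix_measure_add_le:
  fixes A B :: "real^'n^'n"
  assumes N: "is_norm N"
  shows "matrix_measure N (A + B) \<le> matrix_measure N A + matrix_measure N B"
proof -
  define q where "q M h = (induced_norm N (mat 1 + h *\<^sub>R M) - 1) / h" for M :: "real^'n^'n" and h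
  have q: "(q M \<longlongrightarrow> matrix_measure N M) (at_right 0)" for M
    using matrix_measure_tendsto[OF N] by (simp add: q_def[abs_def])
  have dbl: "filterlim (\<lambda>h::real. 2 * h) (at_right 0) (at_right 0)"
    by (intro filterlim_times_pos[OF filterlim_ident]) simp_all
  have le: "q (A + B) h \<le> q A (2 * h) + q B (2 * h)" if h: "h > 0" for h
  proof -
    have "induced_norm N (mat 1 + h *\<^sub>R (A + B))
        \<le> induced_norm N (mat 1 + (2 * h) *\<^sub>R A) / 2 + induced_norm N (mat 1 + (2 * h) *\<^sub>R B) / 2"
    proof (rule induced_norm_least[OF N])
      fix x assume x: "N x = 1"
      have "(mat 1 + h *\<^sub>R (A + B)) *v x
          = (1/2) *\<^sub>R (x + (2 * h) *\<^sub>R (A *v x)) + (1/2) *\<^sub>R (x + (2 * h) *\<^sub>R (B *v x))"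
        unfolding mat_plus_scaleR_vector_mult
        by (simp add: matrix_vector_mult_add_rdistrib scaleR_add_right flip: scaleR_add_left)
      then have "N ((mat 1 + h *\<^sub>R (A + B)) *v x)
          \<le> N ((1/2) *\<^sub>R (x + (2 * h) *\<^sub>R (A *v x))) + N ((1/2) *\<^sub>R (x + (2 * h) *\<^sub>R (B *v x)))"
        using is_norm_triangle[OF N] by metis
      also have "\<dots> = N (x + (2 * h) *\<^sub>R (A *v x)) / 2 + N (x + (2 * h) *\<^sub>R (B *v x)) / 2"
        by (simp only: is_norm_scaleR[OF N])
      finally show "N ((mat 1 + h *\<^sub>R (A + B)) *v x)
          \<le> induced_norm N (mat 1 + (2 * h) *\<^sub>R A) / 2 + induced_norm N (mat 1 + (2 * h) *\<^sub>R B) / 2"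
        using is_norm_step_le[OF N, of x "2 * h" A] is_norm_step_le[OF N, of x "2 * h" B] x by simp
    qed
    then have "(induced_norm N (mat 1 + h *\<^sub>R (A + B)) - 1) / h
        \<le> (induced_norm N (mat 1 + (2 * h) *\<^sub>R A) / 2 + induced_norm N (mat 1 + (2 * h) *\<^sub>R B) / 2 - 1) / h"
      using h by (intro divide_right_mono) auto
    also have "\<dots> = q A (2 * h) + q B (2 * h)"
      using h by (simp add: q_def add_divide_distrib diff_divide_distrib)
    finally show ?thesis by (simp only: q_def)
  qed
  have "((\<lambda>h. q A (2 * h) + q B (2 * h)) \<longlongrightarrow> matrix_measure N A + matrix_measure N B) (at_right 0)"
    using tendsto_add[OF filterlim_compose[OF q dbl] filterlim_compose[OF q dbl]] .
  from tendsto_le[OF _ this q[of "A + B"]] show ?thesis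
    using le by (auto simp: eventually_at_filter)
qed

text \<open>A step of length \<open>h\<close> along \<open>k *\<^sub>R B\<close> is a step of length
  \<open>k * h\<close> along \<open>B\<close>; positivity of \<open>k\<close> keeps the approach to
  \<open>0\<close> one-sided.\<close>

lemma matrix_measure_scaleR:
  fixes B :: "real^'n^'n"
  assumes N: "is_norm N" and k: "k > 0"
  shows "matrix_measure N (k *\<^sub>R B) = k * matrix_measure N B"
proof -
  let ?q = "\<lambda>M h. (induced_norm N (mat 1 + h *\<^sub>R M) - 1) / h"
  have "filterlim (\<lambda>h::real. k * h) (at_right 0) (at_right 0)"
    using k by (intro filterlim_times_pos[OF filterlim_ident]) simp_all
  from filterlim_compose[OF matrix_measure_tendsto[OF N, of B] this]
  have "((\<lambda>h. k * ?q B (k * h)) \<longlongrightarrow> k * matrix_measure N B) (at_right 0)"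
    by (rule tendsto_mult_left)
  moreover have "k * ?q B (k * h) = ?q (k *\<^sub>R B) h" for h
    using k by (simp add: mult.commute)
  ultimately show ?thesis
    using tendsto_unique[OF _ matrix_measure_tendsto[OF N, of "k *\<^sub>R B"]] by simp
qed

section \<open>Dissipativity of linear fields and of the relay\<close>

text \<open>The point \<open>w\<close> lies on the segment between the backward step of length
  \<open>h\<close> and a forward step of length \<open>s\<close>. Letting only \<open>s\<close> tend
  to 0 turns the forward quotient into the measure while \<open>h\<close> stays fixed, so the bound
  holds for each \<open>h\<close> without remainder.\<close>

lemma matrix_measure_backward_step:
  fixes M :: "real^'n^'n"
  assumes N: "is_norm N" and h: "h > 0"
  shows "(1 - h * matrix_measure N M) * N w \<le> N (w - h *\<^sub>R (M *v w))"
proof -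
  let ?q = "\<lambda>s. (induced_norm N (mat 1 + s *\<^sub>R M) - 1) / s"
  have "N w - h * (?q s * N w) \<le> N (w - h *\<^sub>R (M *v w))" if s: "s > 0" for s
  proof -
    define p where "p = induced_norm N (mat 1 + s *\<^sub>R M)"
    have "(s + h) *\<^sub>R w = s *\<^sub>R (w - h *\<^sub>R (M *v w)) + h *\<^sub>R (w + s *\<^sub>R (M *v w))"
      by (simp add: algebra_simps)
    then have "N ((s + h) *\<^sub>R w) \<le> N (s *\<^sub>R (w - h *\<^sub>R (M *v w))) + N (h *\<^sub>R (w + s *\<^sub>R (M *v w)))"
      using is_norm_triangle[OF N] by metis
    then have "(s + h) * N w \<le> s * N (w - h *\<^sub>R (M *v w)) + h * N (w + s *\<^sub>R (M *v w))"
      using s h by (simp add: is_norm_scaleR[OF N])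
    also have "h * N (w + s *\<^sub>R (M *v w)) \<le> h * (p * N w)"
      using h is_norm_step_le[OF N, of w s M] by (simp add: p_def)
    finally have "s * N w - h * ((p - 1) * N w) \<le> s * N (w - h *\<^sub>R (M *v w))"
      by (simp add: algebra_simps)
    moreover have "s * (N w - h * ((p - 1) / s * N w)) = s * N w - h * ((p - 1) * N w)"
      using s by (simp add: right_diff_distrib)
    ultimately have "s * (N w - h * ((p - 1) / s * N w)) \<le> s * N (w - h *\<^sub>R (M *v w))" by simp
    then show ?thesis using s by (simp add: p_def)
  qed
  moreover have "((\<lambda>s. N w - h * (?q s * N w)) \<longlongrightarrow> N w - h * (matrix_measure N M * N w)) (at_right 0)"
    by (intro tendsto_intros matrix_measure_tendsto[OF N])
  ultimately have "N w - h * (matrix_measure N M * N w) \<le> N (w - h *\<^sub>R (M *v w))"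
    by (intro tendsto_upperbound) (auto simp: eventually_at_filter)
  then show ?thesis by (simp add: algebra_simps)
qed

lemma outer_prod_vector_mult: "outer_prod b c *v w = (c \<bullet> w) *\<^sub>R b"
  by (simp add: outer_prod_def matrix_vector_mult_def inner_vec_def vec_eq_iff
      sum_distrib_left mult_ac)

text \<open>If \<open>c \<bullet> w \<noteq> 0\<close>, then \<open>l *\<^sub>R b = (k *\<^sub>R outer_prod b c) *v w\<close> with \<open>k \<ge> 0\<close>. The case
  \<open>c \<bullet> w = 0\<close>, with \<open>l\<close> arbitrary, is a limit of this one; a forward step \<open>w + h *\<^sub>R v\<close> would
  not survive that limit with a bound uniform in \<open>k\<close>.\<close>

lemma relay_backward_step:
  fixes A :: "real^'n^'n"
  assumes N: "is_norm N" and "c \<noteq> 0" and A: "matrix_measure N A \<le> - r"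
    and B: "matrix_measure N (- outer_prod b c) = 0"
    and sgn: "l * (c \<bullet> w) \<ge> 0" and h: "h > 0"
  shows "(1 + h * r) * N w \<le> N (w - h *\<^sub>R (A *v w - l *\<^sub>R b))"
proof -
  have step: "(1 + h * r) * N v \<le> N (v - h *\<^sub>R (M *v v))" if "matrix_measure N M \<le> - r" for M v
  proof -
    have "(1 + h * r) * N v \<le> (1 - h * matrix_measure N M) * N v"
      using that h is_norm_nonneg[OF N, of v] mult_left_mono[OF that, of h]
      by (intro mult_right_mono) auto
    also have "\<dots> \<le> N (v - h *\<^sub>R (M *v v))" by (rule matrix_measure_backward_step[OF N h])
    finally show ?thesis .
  qed
  show ?thesis
  proof (cases "l = 0")
    case True
    then show ?thesis using step[OF A, of w] by simp
  next
    case False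
    \<comment> \<open>Moving \<open>w\<close> along \<open>l *\<^sub>R c\<close> adds
      \<open>e * l\<^sup>2 * (c \<bullet> c)\<close> to \<open>l * (c \<bullet> w)\<close> and so
      makes the weak sign condition strict.\<close>
    define v where "v e = w + (e * l) *\<^sub>R c" for e
    have le: "(1 + h * r) * N (v e) \<le> N (v e - h *\<^sub>R (A *v v e - l *\<^sub>R b))" if e: "e > 0" for e
    proof -
      have "l * (c \<bullet> v e) = l * (c \<bullet> w) + e * (l * l) * (c \<bullet> c)"
        by (simp add: v_def inner_add_right algebra_simps)
      moreover have "l * l > 0" using False by (metis not_real_square_gt_zero)
      then have "e * (l * l) * (c \<bullet> c) > 0" using e \<open>c \<noteq> 0\<close> by simp
      ultimately have pos: "l * (c \<bullet> v e) > 0" using sgn by linarith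
      \<comment> \<open>With this \<open>k\<close> the matrix
        \<open>A + k *\<^sub>R (- outer_prod b c)\<close> sends \<open>v e\<close> to
        \<open>A *v v e - l *\<^sub>R b\<close>, and its measure is at most \<open>- r\<close>
        whatever the size of \<open>k\<close>.\<close>
      define k where "k = l / (c \<bullet> v e)"
      have k: "k > 0" using pos by (auto simp: k_def zero_less_divide_iff zero_less_mult_iff)
      have "matrix_measure N (A + k *\<^sub>R (- outer_prod b c)) \<le> - r"
        using matrix_measure_add_le[OF N, of A "k *\<^sub>R (- outer_prod b c)"] A B
        by (simp only: matrix_measure_scaleR[OF N k])
      from step[OF this, of "v e"] show ?thesis
        using pos by (cases "c \<bullet> v e = 0") (simp_all add: matrix_vector_mult_add_rdistrib outer_prod_vector_mult k_def
            matrix_vector_mult_diff_rdistrib flip: scaleR_matrix_vector_assoc)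
    qed
    have cont: "continuous_on UNIV N" by (rule is_norm_continuous_on[OF N])
    have v: "(v \<longlongrightarrow> w) (at_right 0)"
      unfolding v_def by (rule tendsto_eq_intros refl tendsto_ident_at | simp)+
    have "((\<lambda>e. (1 + h * r) * N (v e)) \<longlongrightarrow> (1 + h * r) * N w) (at_right 0)"
      by (intro tendsto_intros continuous_on_tendsto_compose[OF cont] v) auto
    moreover have "((\<lambda>e. N (v e - h *\<^sub>R (A *v v e - l *\<^sub>R b))) \<longlongrightarrow> N (w - h *\<^sub>R (A *v w - l *\<^sub>R b))) (at_right 0)"
      by (intro continuous_on_tendsto_compose[OF cont] tendsto_intros v
          bounded_linear.tendsto[OF matrix_vector_mul_bounded_linear]) auto
    ultimately show ?thesis
      using le by (intro tendsto_le[of "at_right (0::real)"]) (auto simp: eventually_at_filter)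
  qed
qed


section \<open>Absolutely continuous functions and left Dini derivatives\<close>

lemma absolutely_continuous_on_IccE:
  assumes "absolutely_continuous_on_Icc f a b" "e > 0"
  obtains d where "d > 0" "\<And>D. finite D \<Longrightarrow> (\<forall>(u, v)\<in>D. a \<le> u \<and> u \<le> v \<and> v \<le> b) \<Longrightarrow>
    pairwise (\<lambda>p q. disjnt {fst p<..<snd p} {fst q<..<snd q}) D \<Longrightarrow>
    (\<Sum>(u, v)\<in>D. v - u) < d \<Longrightarrow> (\<Sum>(u, v)\<in>D. norm (f v - f u)) < e"
proof -
  obtain d where "d > 0" and d: "\<forall>D. finite D \<longrightarrow> (\<forall>(u, v)\<in>D. a \<le> u \<and> u \<le> v \<and> v \<le> b) \<longrightarrow>
    pairwise (\<lambda>p q. disjnt {fst p<..<snd p} {fst q<..<snd q}) D \<longrightarrow>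
    (\<Sum>(u, v)\<in>D. v - u) < d \<longrightarrow> (\<Sum>(u, v)\<in>D. norm (f v - f u)) < e"
    using assms(1)[unfolded absolutely_continuous_on_Icc_def, rule_format, OF assms(2)] by (elim exE conjE)
  then show ?thesis by (intro that[of d]) simp_all
qed

lemma absolutely_continuous_on_Icc_continuous_on:
  assumes "absolutely_continuous_on_Icc f a b"
  shows "continuous_on {a..b} f"
  unfolding continuous_on_iff
proof (intro ballI allI impI)
  fix t e :: real assume t: "t \<in> {a..b}" and "e > 0"
  then obtain d where d: "d > 0" and D: "\<And>D. finite D \<Longrightarrow> (\<forall>(u, v)\<in>D. a \<le> u \<and> u \<le> v \<and> v \<le> b) \<Longrightarrow>
        pairwise (\<lambda>p q. disjnt {fst p<..<snd p} {fst q<..<snd q}) D \<Longrightarrow>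
        (\<Sum>(u, v)\<in>D. v - u) < d \<Longrightarrow> (\<Sum>(u, v)\<in>D. norm (f v - f u)) < e"
    using absolutely_continuous_on_IccE[OF assms] by blast
  have "dist (f s) (f t) < e" if "s \<in> {a..b}" "dist s t < d" for s
    using t that D[of "{(min s t, max s t)}"]
    by (cases "s \<le> t") (auto simp: dist_norm dist_real_def min_def max_def norm_minus_commute)
  with d show "\<exists>d>0. \<forall>s\<in>{a..b}. dist s t < d \<longrightarrow> dist (f s) (f t) < e" by blast
qed

text \<open>Meant for a weighted distance between two solutions: the term \<open>v - u\<close>
  absorbs the variation of a Lipschitz weight. The three terms share the tolerance equally, whence
  \<open>3 * L\<close>.\<close>

lemma absolutely_continuous_on_Icc_dominated:
  assumes x: "absolutely_continuous_on_Icc x a b" and z: "absolutely_continuous_on_Icc z a b"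
    and L: "L > 0"
    and le: "\<And>u v. a \<le> u \<Longrightarrow> u \<le> v \<Longrightarrow> v \<le> b \<Longrightarrow>
      norm (f v - f u) \<le> L * (norm (x v - x u) + norm (z v - z u) + (v - u))"
  shows "absolutely_continuous_on_Icc f a b"
  unfolding absolutely_continuous_on_Icc_def
proof (intro allI impI)
  fix e :: real assume "e > 0"
  then have e: "e / (3 * L) > 0" using L by simp
  obtain d1 where d1: "d1 > 0" "\<And>D. finite D \<Longrightarrow> (\<forall>(u, v)\<in>D. a \<le> u \<and> u \<le> v \<and> v \<le> b) \<Longrightarrow>
        pairwise (\<lambda>p q. disjnt {fst p<..<snd p} {fst q<..<snd q}) D \<Longrightarrow>
        (\<Sum>(u, v)\<in>D. v - u) < d1 \<Longrightarrow> (\<Sum>(u, v)\<in>D. norm (x v - x u)) < e / (3 * L)"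
    using absolutely_continuous_on_IccE[OF x e] by blast
  obtain d2 where d2: "d2 > 0" "\<And>D. finite D \<Longrightarrow> (\<forall>(u, v)\<in>D. a \<le> u \<and> u \<le> v \<and> v \<le> b) \<Longrightarrow>
        pairwise (\<lambda>p q. disjnt {fst p<..<snd p} {fst q<..<snd q}) D \<Longrightarrow>
        (\<Sum>(u, v)\<in>D. v - u) < d2 \<Longrightarrow> (\<Sum>(u, v)\<in>D. norm (z v - z u)) < e / (3 * L)"
    using absolutely_continuous_on_IccE[OF z e] by blast
  show "\<exists>d>0. \<forall>D. finite D \<longrightarrow> (\<forall>(u, v)\<in>D. a \<le> u \<and> u \<le> v \<and> v \<le> b) \<longrightarrow>
        pairwise (\<lambda>p q. disjnt {fst p<..<snd p} {fst q<..<snd q}) D \<longrightarrow>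
        (\<Sum>(u, v)\<in>D. v - u) < d \<longrightarrow> (\<Sum>(u, v)\<in>D. norm (f v - f u)) < e"
  proof (intro exI[of _ "min (e / (3 * L)) (min d1 d2)"] conjI allI impI)
    show "min (e / (3 * L)) (min d1 d2) > 0" using e d1 d2 by simp
    fix D assume D: "finite D" "\<forall>(u, v)\<in>D. a \<le> u \<and> u \<le> v \<and> v \<le> b"
      "pairwise (\<lambda>p q. disjnt {fst p<..<snd p} {fst q<..<snd q}) D"
      "(\<Sum>(u, v)\<in>D. v - u) < min (e / (3 * L)) (min d1 d2)"
    have "(\<Sum>(u, v)\<in>D. norm (f v - f u))
        \<le> (\<Sum>(u, v)\<in>D. L * (norm (x v - x u) + norm (z v - z u) + (v - u)))"
      using D(2) le by (intro sum_mono) auto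
    also have "\<dots> = L * ((\<Sum>(u, v)\<in>D. norm (x v - x u)) + (\<Sum>(u, v)\<in>D. norm (z v - z u))
        + (\<Sum>(u, v)\<in>D. v - u))"
      by (simp add: case_prod_unfold sum.distrib flip: sum_distrib_left)
    also have "\<dots> < L * (e / (3 * L) + e / (3 * L) + e / (3 * L))"
      using L d1(2)[OF D(1-3)] d2(2)[OF D(1-3)] D(4) by (intro mult_strict_left_mono) auto
    also have "\<dots> = e" using L by (simp add: field_simps)
    finally show "(\<Sum>(u, v)\<in>D. norm (f v - f u)) < e" .
  qed
qed

text \<open>Makes every family of nonoverlapping intervals inside a set of small measure admissible
  in the definition of absolute continuity.\<close>

lemma sum_disjoint_Ioo_le_measure:
  fixes D :: "(real \<times> real) set"
  assumes "finite D" "\<forall>(u, v)\<in>D. u \<le> v \<and> {u<..<v} \<subseteq> S"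
    and "pairwise (\<lambda>p q. disjnt {fst p<..<snd p} {fst q<..<snd q}) D"
    and S: "S \<in> lmeasurable"
  shows "(\<Sum>(u, v)\<in>D. v - u) \<le> measure lebesgue S"
proof -
  have "(\<Sum>(u, v)\<in>D. v - u) = (\<Sum>p\<in>D. measure lebesgue {fst p<..<snd p})"
    using assms(2) by (intro sum.cong) (auto simp: case_prod_unfold)
  also have "\<dots> = measure lebesgue (\<Union>p\<in>D. {fst p<..<snd p})"
    using assms(1-3)
    by (intro measure_finite_Union[symmetric])
      (auto simp: disjoint_family_on_def pairwise_def disjnt_def)
  also have "\<dots> \<le> measure lebesgue S"
    using assms by (intro measure_mono_fmeasurable S) (auto simp: case_prod_unfold)
  finally show ?thesis .
qed

text \<open>Cover the exceptional null set by an open set \<open>S\<close> on which \<open>f\<close> has variation below \<open>\<epsilon>\<close>, and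
  let \<open>V t\<close> be the variation of \<open>f\<close> on \<open>S \<inter> {a..t}\<close>. Then \<open>f t - V t - \<epsilon> * t\<close> does not increase
  across a short interval to the left of any point \<open>t\<close>.\<close>

lemma absolutely_continuous_left_Dini_le:
  fixes f :: "real \<Rightarrow> real"
  assumes ab: "a \<le> b" and ac: "absolutely_continuous_on_Icc f a b"
    and dini: "AE t in lebesgue. t \<in> {a<..b} \<longrightarrow>
      (\<forall>\<epsilon>>0. \<exists>\<eta>>0. \<forall>s\<in>{a..<t}. t - s < \<eta> \<longrightarrow> f t \<le> f s + \<epsilon> * (t - s))"
  shows "f b \<le> f a"
proof -
  let ?P = "\<lambda>t \<epsilon>. \<exists>\<eta>>0. \<forall>s\<in>{a..<t}. t - s < \<eta> \<longrightarrow> f t \<le> f s + \<epsilon> * (t - s)"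
  \<comment> \<open>The first error term bounds the variation over the open cover, the second comes
    from the slope \<epsilon> allowed outside it.\<close>
  have main: "f b \<le> f a + \<epsilon> + \<epsilon> * (b - a)" if \<epsilon>: "\<epsilon> > 0" for \<epsilon>
  proof -
    obtain \<delta> where \<delta>: "\<delta> > 0" and D: "\<And>D. finite D \<Longrightarrow> (\<forall>(u, v)\<in>D. a \<le> u \<and> u \<le> v \<and> v \<le> b) \<Longrightarrow>
        pairwise (\<lambda>p q. disjnt {fst p<..<snd p} {fst q<..<snd q}) D \<Longrightarrow>
        (\<Sum>(u, v)\<in>D. v - u) < \<delta> \<Longrightarrow> (\<Sum>(u, v)\<in>D. norm (f v - f u)) < \<epsilon>"
      using absolutely_continuous_on_IccE[OF ac \<epsilon>] by blast
    obtain E where E: "E \<in> null_sets lebesgue" and good: "\<And>t. t \<in> {a<..b} \<Longrightarrow> t \<notin> E \<Longrightarrow> ?P t \<epsilon>"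
    proof (rule AE_E3[OF dini])
      fix E assume "E \<in> null_sets lebesgue"
        and "\<And>t. t \<in> space lebesgue - E \<Longrightarrow> t \<in> {a<..b} \<longrightarrow> (\<forall>\<epsilon>>0. ?P t \<epsilon>)"
      then show thesis using \<epsilon> by (intro that[of E]) simp_all
    qed
    obtain S where S: "open S" "E \<subseteq> S" "S - E \<in> lmeasurable" "emeasure lebesgue (S - E) < ennreal \<delta>"
      using sets_lebesgue_outer_open[of E \<delta>] E \<delta> by blast
    \<comment> \<open>Outer regularity controls only \<open>S - E\<close>; since \<open>E\<close> is
      null, \<open>S\<close> has the same measure.\<close>
    have "emeasure lebesgue S = emeasure lebesgue (S - E)"
      using S(1) by (intro emeasure_Diff_null_set[OF E, symmetric]) auto
    with S(4) have em: "emeasure lebesgue S < ennreal \<delta>" by simp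
    then have Sm: "S \<in> lmeasurable"
      using S(1) by (intro fmeasurableI) (auto intro: less_trans[OF _ ennreal_less_top])
    then have "measure lebesgue S < \<delta>"
      using em emeasure_eq_measure2[OF Sm] by (simp add: ennreal_less_iff)
    note Sm = Sm this
    define \<D> where "\<D> t = {D. finite D \<and>
        (\<forall>p\<in>D. a \<le> fst p \<and> fst p \<le> snd p \<and> snd p \<le> t \<and> {fst p<..<snd p} \<subseteq> S) \<and>
        pairwise (\<lambda>p q. disjnt {fst p<..<snd p} {fst q<..<snd q}) D}" for t
    define var where "var D = (\<Sum>(u, v)\<in>D. norm (f v - f u))" for D
    define V where "V t = (SUP D\<in>\<D> t. var D)" for t
    have var_le: "var D \<le> \<epsilon>" if "D \<in> \<D> t" "t \<le> b" for D t
    proof -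
      have "(\<Sum>(u, v)\<in>D. v - u) \<le> measure lebesgue S"
        using that by (intro sum_disjoint_Ioo_le_measure Sm) (auto simp: \<D>_def case_prod_unfold)
      with Sm(2) that show ?thesis unfolding var_def
        by (intro less_imp_le D) (auto simp: \<D>_def case_prod_unfold intro: order_trans[of _ t b])
    qed
    have bdd: "bdd_above (var ` \<D> t)" if "t \<le> b" for t
      using var_le that by (intro bdd_aboveI2)
    have ne: "{} \<in> \<D> t" for t by (simp add: \<D>_def)
    have V_nonneg: "0 \<le> V t" if "t \<le> b" for t
      unfolding V_def using cSUP_upper[OF ne bdd[OF that]] by (simp add: var_def)
    have V_le: "V t \<le> \<epsilon>" if "t \<le> b" for t
      unfolding V_def using ne var_le that by (intro cSUP_least) auto
    have V_mono: "V s \<le> V t" if "s \<le> t" "t \<le> b" for s t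
    proof -
      have "\<D> s \<subseteq> \<D> t" by (auto simp: \<D>_def intro: order_trans[OF _ \<open>s \<le> t\<close>])
      then show ?thesis unfolding V_def using ne that by (intro cSUP_subset_mono bdd) auto
    qed
    \<comment> \<open>A family ending by \<open>s\<close> can be extended by the interval from
      \<open>s\<close> to \<open>t\<close>, which overlaps none of its members.\<close>
    have V_step: "V s + \<bar>f t - f s\<bar> \<le> V t" if "a \<le> s" "s < t" "t \<le> b" "{s<..<t} \<subseteq> S" for s t
    proof -
      have "var D \<le> V t - \<bar>f t - f s\<bar>" if DD: "D \<in> \<D> s" for D
      proof -
        have le: "snd p \<le> s" if "p \<in> D" for p using DD that by (simp add: \<D>_def)
        have fin: "finite D" using DD by (simp add: \<D>_def)
        have "(s, t) \<notin> D" using le[of "(s, t)"] \<open>s < t\<close> by auto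
        then have "var (insert (s, t) D) = \<bar>f t - f s\<bar> + var D"
          using fin by (simp add: var_def)
        moreover have "insert (s, t) D \<in> \<D> t"
        proof -
          have "disjnt {fst p<..<snd p} {s<..<t}" if "p \<in> D" for p
            using le[OF that] by (auto simp: disjnt_iff)
          moreover have "snd p \<le> t" if "p \<in> D" for p using le[OF that] \<open>s < t\<close> by simp
          ultimately show ?thesis
            using DD \<open>a \<le> s\<close> \<open>s < t\<close> \<open>{s<..<t} \<subseteq> S\<close>
            by (simp add: \<D>_def pairwise_insert disjnt_sym)
        qed
        then have "var (insert (s, t) D) \<le> V t"
          unfolding V_def using bdd[OF \<open>t \<le> b\<close>] by (rule cSUP_upper)
        ultimately show ?thesis by simp
      qed
      then have "V s \<le> V t - \<bar>f t - f s\<bar>"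
        unfolding V_def[of s] using ne by (intro cSUP_least) auto
      then show ?thesis by simp
    qed
    define F where "F t = f t - V t - \<epsilon> * t" for t
    have step: "\<exists>s\<in>{a..<t}. F t \<le> F s" if t: "t \<in> {a<..b}" for t
    proof -
      have "\<exists>\<eta>>0. \<forall>s\<in>{a..<t}. t - s < \<eta> \<longrightarrow> F t \<le> F s"
      proof (cases "t \<in> S")
        case True
        then obtain \<eta> where \<eta>: "\<eta> > 0" "ball t \<eta> \<subseteq> S" using S(1) openE by blast
        have "F t \<le> F s" if s: "s \<in> {a..<t}" "t - s < \<eta>" for s
        proof -
          have "{s<..<t} \<subseteq> ball t \<eta>" using s by (auto simp: dist_real_def)
          then have "V s + \<bar>f t - f s\<bar> \<le> V t" using s t \<eta> by (intro V_step) auto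
          moreover have "\<epsilon> * s \<le> \<epsilon> * t" using s \<epsilon> by simp
          ultimately show ?thesis by (simp add: F_def)
        qed
        with \<eta>(1) show ?thesis by blast
      next
        case False
        then obtain \<eta> where \<eta>: "\<eta> > 0" "\<And>s. s \<in> {a..<t} \<Longrightarrow> t - s < \<eta> \<Longrightarrow> f t \<le> f s + \<epsilon> * (t - s)"
          using good[OF t] S(2) by blast
        have "F t \<le> F s" if s: "s \<in> {a..<t}" "t - s < \<eta>" for s
          using \<eta>(2)[OF s] V_mono[of s t] s t by (simp add: F_def algebra_simps)
        with \<eta>(1) show ?thesis by blast
      qed
      then obtain \<eta> where "\<eta> > 0" "\<And>s. s \<in> {a..<t} \<Longrightarrow> t - s < \<eta> \<Longrightarrow> F t \<le> F s" by blast
      moreover from this have "max a (t - \<eta> / 2) \<in> {a..<t}" "t - max a (t - \<eta> / 2) < \<eta>"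
        using t by (auto simp: max_def)
      ultimately show ?thesis by blast
    qed
    \<comment> \<open>Backward continuation: if the infimum of \<open>X\<close> belongs to
      \<open>X\<close>, then \<open>step\<close> would push it further left unless it equals
      \<open>a\<close>.\<close>
    define X where "X = {t \<in> {a..b}. F b \<le> F t}"
    define m where "m = Inf X"
    have "b \<in> X" using ab by (simp add: X_def)
    have bdX: "bdd_below X" by (auto simp: X_def)
    have m: "a \<le> m" "m \<le> b"
      unfolding m_def using \<open>b \<in> X\<close> bdX by (auto simp: X_def intro: cInf_lower cInf_greatest)
    \<comment> \<open>\<open>F\<close> cannot jump up just to the right of \<open>m\<close>:
      \<open>f t - \<epsilon> * t\<close> is continuous, and subtracting the monotone
      \<open>V\<close> permits only downward jumps.\<close>
    have "F b \<le> F m"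
    proof (rule ccontr)
      assume "\<not> F b \<le> F m"
      then have less: "f m - \<epsilon> * m < F b + V m" by (simp add: F_def)
      have "continuous_on {a..b} (\<lambda>t. f t - \<epsilon> * t)"
        by (intro continuous_intros absolutely_continuous_on_Icc_continuous_on ac)
      then obtain d where d: "d > 0" "\<And>t. t \<in> {a..b} \<Longrightarrow> dist t m < d \<Longrightarrow>
          dist (f t - \<epsilon> * t) (f m - \<epsilon> * m) < F b + V m - (f m - \<epsilon> * m)"
        using m less unfolding continuous_on_iff
        by (elim ballE[of _ _ m] allE[of _ "F b + V m - (f m - \<epsilon> * m)"]) auto
      obtain t where t: "t \<in> X" "t < m + d"
        using cInf_less_iff[OF _ bdX, of "m + d"] \<open>b \<in> X\<close> d(1) by (auto simp: m_def)
      have "m \<le> t" unfolding m_def using t(1) bdX by (rule cInf_lower)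
      then have "f t - \<epsilon> * t < F b + V m"
        using d(2)[of t] t by (auto simp: X_def dist_real_def)
      moreover have "V m \<le> V t" using \<open>m \<le> t\<close> t(1) by (intro V_mono) (auto simp: X_def)
      ultimately show False using t(1) by (simp add: X_def F_def)
    qed
    have "m = a"
    proof (rule ccontr)
      assume "m \<noteq> a"
      then obtain s where "s \<in> {a..<m}" "F m \<le> F s" using step[of m] m by auto
      then have "s \<in> X" using m \<open>F b \<le> F m\<close> by (auto simp: X_def)
      then have "m \<le> s" unfolding m_def using bdX by (rule cInf_lower)
      with \<open>s \<in> {a..<m}\<close> show False by simp
    qed
    with \<open>F b \<le> F m\<close> V_nonneg[OF ab] V_le[of b] show ?thesis
      by (simp add: F_def algebra_simps)
  qed
  have "((\<lambda>\<epsilon>. f a + \<epsilon> + \<epsilon> * (b - a)) \<longlongrightarrow> f a + 0 + 0 * (b - a)) (at_right 0)"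
    by (intro tendsto_intros)
  then have "f b \<le> f a + 0 + 0 * (b - a)"
    using main by (intro tendsto_lowerbound) (auto simp: eventually_at_filter)
  then show ?thesis by simp
qed

section \<open>Filippov values of the relay field\<close>

text \<open>On a small ball the field takes values in an \<open>e\<close>-neighbourhood of the
  compact convex set \<open>R\<close> of candidates. The neighbourhood is closed and convex, so it
  also contains the closed convex hull; then \<open>e\<close> is arbitrary. Taking the empty set for
  \<open>Z\<close> gives this bound on the intersection.\<close>

lemma filippov_map_relay_field:
  fixes A :: "real^'n^'n"
  assumes "c \<noteq> 0" and v: "v \<in> filippov_map U (relay_field A b c) x"
  obtains s where "v = A *v x - s *\<^sub>R b" "\<bar>s\<bar> \<le> 1" "s * (c \<bullet> x) = \<bar>c \<bullet> x\<bar>"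
proof -
  define I where "I = {s. \<bar>s\<bar> \<le> 1 \<and> s * (c \<bullet> x) = \<bar>c \<bullet> x\<bar>}"
  have I: "I = (if c \<bullet> x = 0 then {-1..1} else {sgn (c \<bullet> x)})"
    by (auto simp: I_def abs_sgn[of "c \<bullet> x"] mult.commute abs_le_iff) (auto simp: sgn_if)
  define R where "R = (\<lambda>s. A *v x - s *\<^sub>R b) ` I"
  have "compact R" unfolding R_def
    by (intro compact_continuous_image continuous_intros) (simp add: I)
  have "convex ((+) (A *v x) ` (\<lambda>s. s *\<^sub>R (- b)) ` I)"
    by (intro convex_translation convex_linear_image bounded_linear.linear bounded_linear_scaleR_left)
      (simp add: I)
  moreover have "(+) (A *v x) ` (\<lambda>s. s *\<^sub>R (- b)) ` I = R"
    by (simp add: R_def image_image)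
  ultimately have "convex R" by metis
  obtain B where B: "B > 0" "\<And>y. norm (A *v y) \<le> norm y * B"
    using bounded_linear.pos_bounded[OF matrix_vector_mul_bounded_linear[of A]] by blast
  have "v \<in> closure R"
    unfolding closure_approachable_le
  proof (intro allI impI)
    fix e :: real assume "e > 0"
    define T where "T = (\<Union>r\<in>R. \<Union>y\<in>cball 0 e. {r + y})"
    have T: "closed T" "convex T"
      using \<open>compact R\<close> \<open>convex R\<close> unfolding T_def by (auto intro!: compact_closed_sums convex_sums)
    \<comment> \<open>\<open>e / B\<close> limits the change of the linear part;
      \<open>\<bar>c \<bullet> x\<bar> / norm c\<close> is the distance from \<open>x\<close> to the
      switching hyperplane, so the sign is constant on the ball. On the hyperplane every sign is
      allowed, including \<open>sgn 0 = 0\<close>.\<close>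
    define d where "d = (if c \<bullet> x = 0 then e / B else min (e / B) (\<bar>c \<bullet> x\<bar> / norm c))"
    have d: "d > 0" using \<open>e > 0\<close> \<open>c \<noteq> 0\<close> B(1) by (auto simp: d_def)
    have "relay_field A b c y \<in> T" if y: "y \<in> ball x d" for y
    proof -
      have "sgn (c \<bullet> y) \<in> I"
      proof (cases "c \<bullet> x = 0")
        case False
        then have c: "norm c > 0" by auto
        have "\<bar>c \<bullet> y - c \<bullet> x\<bar> \<le> norm c * norm (y - x)"
          using Cauchy_Schwarz_ineq2[of c "y - x"] by (simp add: inner_diff_right)
        also have "\<dots> < norm c * (\<bar>c \<bullet> x\<bar> / norm c)"
          using y False c by (intro mult_strict_left_mono) (auto simp: d_def dist_norm norm_minus_commute)
        finally have "\<bar>c \<bullet> y - c \<bullet> x\<bar> < \<bar>c \<bullet> x\<bar>" using c by simp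
        then have "sgn (c \<bullet> y) = sgn (c \<bullet> x)" by (auto simp: sgn_if abs_if split: if_splits)
        with False show ?thesis by (simp add: I)
      qed (simp add: I sgn_if)
      then have "A *v x - sgn (c \<bullet> y) *\<^sub>R b \<in> R" unfolding R_def by (rule imageI)
      moreover have "norm (A *v (y - x)) \<le> e"
      proof -
        have "norm (y - x) \<le> e / B"
          using y by (auto simp: d_def dist_norm norm_minus_commute split: if_splits)
        then have "norm (y - x) * B \<le> e" using B(1) by (simp add: field_simps)
        with B(2)[of "y - x"] show ?thesis by simp
      qed
      moreover have "relay_field A b c y = (A *v x - sgn (c \<bullet> y) *\<^sub>R b) + A *v (y - x)"
        by (simp add: relay_field_def matrix_vector_mult_diff_distrib)
      ultimately show ?thesis unfolding T_def by (auto intro!: bexI)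
    qed
    then have "closure (convex hull (relay_field A b c ` (ball x d \<inter> U - {}))) \<subseteq> T"
      using T by (intro closure_minimal hull_minimal) auto
    moreover have "v \<in> closure (convex hull (relay_field A b c ` (ball x d \<inter> U - {})))"
      using v d unfolding filippov_map_def by (blast intro: negligible_empty)
    ultimately have "v \<in> T" by blast
    then obtain r y where "r \<in> R" "norm y \<le> e" "v = r + y" by (auto simp: T_def)
    then show "\<exists>r\<in>R. dist r v \<le> e" by (auto intro!: bexI[of _ r] simp: dist_norm)
  qed
  then have "v \<in> R" using \<open>compact R\<close> by (simp add: compact_imp_closed)
  then show ?thesis using that by (auto simp: R_def I_def)
qed

section \<open>Contraction of two Filippov solutions\<close>

lemma relay_solutions_contract:
  fixes A :: "real^'n^'n"
  assumes N: "is_norm N" and c: "c \<noteq> 0" and A: "matrix_measure N A \<le> - r"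
    and B: "matrix_measure N (- outer_prod b c) = 0"
    and J: "forward_interval t0 J"
    and x: "filippov_solution U (relay_field A b c) J x"
    and z: "filippov_solution U (relay_field A b c) J z"
    and T: "T \<in> J"
  shows "N (x T - z T) \<le> exp (- r * (T - t0)) * N (x t0 - z t0)"
proof -
  obtain L where L: "L > 0" "\<And>y. N y \<le> L * norm y" "\<And>y y'. \<bar>N y - N y'\<bar> \<le> L * norm (y - y')"
    using is_norm_lipschitz[OF N] by metis
  have t0T: "t0 \<le> T" "t0 \<in> J" using J T by (auto simp: forward_interval_def)
  have sub: "{t0..T} \<subseteq> J"
    using J T unfolding forward_interval_def by (auto intro: mem_is_interval_1_I)
  have acx: "absolutely_continuous_on_Icc x t0 T" and acz: "absolutely_continuous_on_Icc z t0 T"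
    using x z T t0T by (auto simp: filippov_solution_def)
  define w where "w t = x t - z t" for t
  define g where "g t = N (w t)" for t
  define f where "f t = exp (r * t) * g t" for t
  have contw: "continuous_on {t0..T} w"
    unfolding w_def by (intro continuous_intros absolutely_continuous_on_Icc_continuous_on acx acz)
  have contg: "continuous_on {t0..T} g"
    unfolding g_def by (rule continuous_on_compose2[OF is_norm_continuous_on[OF N] contw]) auto
  obtain G where G: "G > 0" "\<And>t. t \<in> {t0..T} \<Longrightarrow> \<bar>g t\<bar> \<le> G"
    using compact_imp_bounded[OF compact_continuous_image[OF contg]] unfolding bounded_pos by auto
  obtain E where E: "E > 0" "\<And>t. t \<in> {t0..T} \<Longrightarrow> \<bar>exp (r * t)\<bar> \<le> E"
  proof -
    have "continuous_on {t0..T} (\<lambda>t. exp (r * t))" by (intro continuous_intros)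
    from compact_imp_bounded[OF compact_continuous_image[OF this]] that show ?thesis
      unfolding bounded_pos by auto
  qed
  have ac: "absolutely_continuous_on_Icc f t0 T"
  proof (rule absolutely_continuous_on_Icc_dominated[OF acx acz])
    \<comment> \<open>\<open>E * L\<close> bounds the variation due to \<open>N\<close>, and
      \<open>\<bar>r\<bar> * E * G\<close> the variation of the exponential weight times the bound
      \<open>G\<close> on the distance.\<close>
    let ?K = "E * L + \<bar>r\<bar> * E * G"
    show "?K > 0" using E G L by (simp add: add_pos_nonneg)
    fix u v assume uv: "t0 \<le> u" "u \<le> v" "v \<le> T"
    have "\<bar>g v - g u\<bar> \<le> L * norm (w v - w u)" unfolding g_def by (rule L)
    also have "norm (w v - w u) \<le> norm (x v - x u) + norm (z v - z u)"
      using norm_triangle_ineq4[of "x v - x u" "z v - z u"] by (simp add: w_def algebra_simps)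
    finally have dg: "\<bar>g v - g u\<bar> \<le> L * (norm (x v - x u) + norm (z v - z u))" using L(1) by simp
    have de: "\<bar>exp (r * v) - exp (r * u)\<bar> \<le> (\<bar>r\<bar> * E) * \<bar>v - u\<bar>"
    proof -
      have "norm (exp (r * v) - exp (r * u)) \<le> (\<bar>r\<bar> * E) * norm (v - u)"
        by (rule field_differentiable_bound[of "{t0..T}" _ "\<lambda>t. r * exp (r * t)"])
          (use uv E in \<open>auto intro!: derivative_eq_intros simp: abs_mult mult_left_mono\<close>)
      then show ?thesis by simp
    qed
    have "f v - f u = exp (r * v) * (g v - g u) + (exp (r * v) - exp (r * u)) * g u"
      by (simp add: f_def algebra_simps)
    then have "\<bar>f v - f u\<bar> \<le> \<bar>exp (r * v)\<bar> * \<bar>g v - g u\<bar> + \<bar>exp (r * v) - exp (r * u)\<bar> * \<bar>g u\<bar>"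
      by (metis abs_mult abs_triangle_ineq)
    also have "\<dots> \<le> E * (L * (norm (x v - x u) + norm (z v - z u))) + (\<bar>r\<bar> * E) * \<bar>v - u\<bar> * G"
      using uv E G by (intro add_mono mult_mono dg de) auto
    also have "\<dots> = (E * L) * (norm (x v - x u) + norm (z v - z u)) + (\<bar>r\<bar> * E * G) * (v - u)"
      using uv by simp
    also have "\<dots> \<le> ?K * (norm (x v - x u) + norm (z v - z u)) + ?K * (v - u)"
      using uv E G L by (intro add_mono mult_right_mono) auto
    finally show "norm (f v - f u) \<le> ?K * (norm (x v - x u) + norm (z v - z u) + (v - u))"
      by (simp add: distrib_left)
  qed
  have "f T \<le> f t0"
  proof (rule absolutely_continuous_left_Dini_le[OF t0T(1) ac])
    let ?D = "\<lambda>y t. t \<in> J \<longrightarrow>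
      (\<exists>v\<in>filippov_map U (relay_field A b c) (y t). (y has_vector_derivative v) (at t within J))"
    have "AE t in lebesgue. ?D x t" "AE t in lebesgue. ?D z t"
      using x z by (auto simp: filippov_solution_def)
    then show "AE t in lebesgue. t \<in> {t0<..T} \<longrightarrow>
      (\<forall>\<epsilon>>0. \<exists>\<eta>>0. \<forall>s\<in>{t0..<t}. t - s < \<eta> \<longrightarrow> f t \<le> f s + \<epsilon> * (t - s))"
    proof eventually_elim
      case (elim t)
      show ?case
      proof (intro impI allI)
        fix \<epsilon> :: real assume t: "t \<in> {t0<..T}" and \<epsilon>: "\<epsilon> > 0"
        then have tJ: "t \<in> J" using sub by auto
        obtain v v' where v: "v \<in> filippov_map U (relay_field A b c) (x t)"
            "(x has_vector_derivative v) (at t within J)"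
          and v': "v' \<in> filippov_map U (relay_field A b c) (z t)"
            "(z has_vector_derivative v') (at t within J)"
          using elim tJ by blast
        obtain p where p: "v = A *v x t - p *\<^sub>R b" "\<bar>p\<bar> \<le> 1" "p * (c \<bullet> x t) = \<bar>c \<bullet> x t\<bar>"
          using filippov_map_relay_field[OF c v(1)] by blast
        obtain q where q: "v' = A *v z t - q *\<^sub>R b" "\<bar>q\<bar> \<le> 1" "q * (c \<bullet> z t) = \<bar>c \<bullet> z t\<bar>"
          using filippov_map_relay_field[OF c v'(1)] by blast
        have le: "k * y \<le> \<bar>y\<bar>" if "\<bar>k\<bar> \<le> 1" for k y :: real
          using mult_right_mono[OF that abs_ge_zero[of y]] abs_ge_self[of "k * y"] by (simp add: abs_mult)
        \<comment> \<open>The product expands to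
          \<open>\<bar>c \<bullet> x t\<bar> - q * (c \<bullet> x t)\<close> plus
          \<open>\<bar>c \<bullet> z t\<bar> - p * (c \<bullet> z t)\<close>, both
          nonnegative.\<close>
        have mono: "(p - q) * (c \<bullet> w t) \<ge> 0"
          using p(3) q(3) le[OF q(2), of "c \<bullet> x t"] le[OF p(2), of "c \<bullet> z t"]
          by (simp add: w_def inner_diff_right left_diff_distrib right_diff_distrib)
        define w' where "w' = A *v w t - (p - q) *\<^sub>R b"
        have "(w has_vector_derivative w') (at t within J)"
          using has_vector_derivative_diff[OF v(2) v'(2)]
          by (simp add: w_def[abs_def] w'_def p q matrix_vector_mult_diff_distrib algebra_simps)
        \<comment> \<open>The differentiation error is later multiplied by the Lipschitz constant
          \<open>L\<close> and the weight bound \<open>E\<close>, which leaves half of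
          \<epsilon>.\<close>
        moreover have "\<epsilon> / (2 * E * L) > 0" using \<epsilon> E L by simp
        ultimately obtain d where d: "d > 0" "\<And>s. s \<in> J \<Longrightarrow> norm (s - t) < d \<Longrightarrow>
            norm (w s - w t - (s - t) *\<^sub>R w') \<le> \<epsilon> / (2 * E * L) * norm (s - t)"
          unfolding has_vector_derivative_def has_derivative_within_alt by blast
        \<comment> \<open>Coefficient of the \<open>h\<^sup>2\<close> error left by
          \<open>(1 - h * r) * (1 + h * r) = 1 - h\<^sup>2 * r\<^sup>2\<close>.\<close>
        define \<kappa> where "\<kappa> = exp (r * t) * r\<^sup>2 * g t"
        have g0: "g t \<ge> 0" by (simp add: g_def is_norm_nonneg[OF N])
        then have \<kappa>: "\<kappa> \<ge> 0" by (simp add: \<kappa>_def)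
        \<comment> \<open>The three bounds serve the differentiation error, the sign of
          \<open>1 + h * r\<close>, and the other half of \<epsilon>, which pays for the
          second-order error.\<close>
        define \<eta> where "\<eta> = min d (min (1 / (\<bar>r\<bar> + 1)) (\<epsilon> / (2 * (\<kappa> + 1))))"
        have \<eta>: "\<eta> > 0" using d(1) \<epsilon> \<kappa> by (simp add: \<eta>_def)
        have "f t \<le> f s + \<epsilon> * (t - s)" if s: "s \<in> {t0..<t}" "t - s < \<eta>" for s
        proof -
          define h where "h = t - s"
          have h: "h > 0" "h < d" "h < 1 / (\<bar>r\<bar> + 1)" "h < \<epsilon> / (2 * (\<kappa> + 1))"
            using s by (auto simp: h_def \<eta>_def)
          have sT: "s \<in> {t0..T}" using s t by auto
          have "h * (\<bar>r\<bar> + 1) < 1" using h(3) by (simp add: field_simps)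
          moreover have "h * \<bar>r\<bar> \<le> h * (\<bar>r\<bar> + 1)" "\<bar>h * r\<bar> = h * \<bar>r\<bar>" using h(1) by (auto simp: abs_mult)
          ultimately have hr: "1 + h * r \<ge> 0" by linarith
          have "(h * 2) * (\<kappa> + 1) < \<epsilon>" using h(4) \<kappa> by (simp add: field_simps)
          then have "\<kappa> * h \<le> \<epsilon> / 2" using h(1) by (simp add: algebra_simps)
          then have \<kappa>h: "\<kappa> * h * h \<le> \<epsilon> / 2 * h" using h(1) by (intro mult_right_mono) auto
          have "norm (w s - w t - (s - t) *\<^sub>R w') \<le> \<epsilon> / (2 * E * L) * norm (s - t)"
            using d(2)[of s] sT sub h by (auto simp: h_def)
          then have err: "norm (w t - h *\<^sub>R w' - w s) \<le> \<epsilon> / (2 * E * L) * h"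
            using h(1) by (simp add: h_def norm_minus_commute algebra_simps)
          have "(1 + h * r) * g t \<le> N (w t - h *\<^sub>R w')"
            unfolding g_def w'_def by (rule relay_backward_step[OF N c A B mono h(1)])
          also have "\<dots> \<le> g s + L * norm (w t - h *\<^sub>R w' - w s)"
            using L(3)[of "w t - h *\<^sub>R w'" "w s"] by (simp add: g_def)
          also have "\<dots> \<le> g s + L * (\<epsilon> / (2 * E * L) * h)"
            using err L(1) by (intro add_left_mono mult_left_mono) auto
          also have "L * (\<epsilon> / (2 * E * L) * h) = \<epsilon> * h / (2 * E)"
            using L(1) by simp
          finally have "exp (r * s) * ((1 + h * r) * g t) \<le> exp (r * s) * (g s + \<epsilon> * h / (2 * E))"
            by (intro mult_left_mono) auto
          also have "\<dots> = f s + exp (r * s) * (\<epsilon> * h / (2 * E))"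
            by (simp add: f_def distrib_left)
          also have "exp (r * s) * (\<epsilon> * h / (2 * E)) \<le> E * (\<epsilon> * h / (2 * E))"
            using E(2)[OF sT] E(1) h(1) \<epsilon> by (intro mult_right_mono) auto
          also have "E * (\<epsilon> * h / (2 * E)) = \<epsilon> / 2 * h" using E(1) by simp
          finally have up: "exp (r * s) * ((1 + h * r) * g t) \<le> f s + \<epsilon> / 2 * h" by simp
          \<comment> \<open>Trades the weight at \<open>s\<close> for the weight at
            \<open>t\<close>, using that the exponential lies above its tangent.\<close>
          have "(1 - h * r) * (1 + h * r) \<le> exp (- h * r) * (1 + h * r)"
            using exp_ge_add_one_self[of "- h * r"] hr by (intro mult_right_mono) auto
          then have "exp (r * t) * g t * ((1 - h * r) * (1 + h * r))
              \<le> exp (r * t) * g t * (exp (- h * r) * (1 + h * r))"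
            using g0 by (intro mult_left_mono) auto
          moreover have "exp (r * t) * exp (- h * r) = exp (r * s)"
            by (simp add: h_def algebra_simps flip: exp_add)
          then have "exp (r * t) * g t * (exp (- h * r) * (1 + h * r)) = exp (r * s) * ((1 + h * r) * g t)"
            by (metis (no_types, lifting) mult.assoc mult.commute)
          moreover have "exp (r * t) * g t * ((1 - h * r) * (1 + h * r)) = f t - \<kappa> * h * h"
            by (simp add: f_def \<kappa>_def power2_eq_square algebra_simps)
          ultimately have "f t - \<kappa> * h * h \<le> f s + \<epsilon> / 2 * h" using up by linarith
          with \<kappa>h show ?thesis by (simp add: h_def[symmetric])
        qed
        with \<eta> have "\<exists>\<eta>>0. \<forall>s\<in>{t0..<t}. t - s < \<eta> \<longrightarrow> f t \<le> f s + \<epsilon> * (t - s)" by blast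
        then
        show "\<exists>\<eta>>0. \<forall>s\<in>{t0..<t}. t - s < \<eta> \<longrightarrow> f t \<le> f s + \<epsilon> * (t - s)"
          .
      qed
    qed
  qed
  then have "exp (r * T) * N (x T - z T) \<le> exp (r * t0) * N (x t0 - z t0)"
    by (simp add: f_def g_def w_def)
  then have "exp (- r * T) * (exp (r * T) * N (x T - z T)) \<le> exp (- r * T) * (exp (r * t0) * N (x t0 - z t0))"
    by (intro mult_left_mono) auto
  then show ?thesis
    by (simp add: algebra_simps flip: mult.assoc exp_add)
qed

theorem proposition5:
  fixes A :: "real^'n^'n" and b c :: "real^'n"
    and U C :: "(real^'n) set"
    and N :: "real^'n \<Rightarrow> real" and K cbar :: real
  assumes "c \<noteq> 0"
    and "open U" and "C \<subseteq> U"
    and "right_unique_solutions U (relay_field A b c)"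
    and "forward_invariant U (relay_field A b c) C"
    and "is_norm N"
    and "K_reachable N K C"
    and "cbar > 0"
    and "matrix_measure N A \<le> - cbar"
    and "matrix_measure N (- outer_prod b c) = 0"
  shows "incrementally_exp_stable U (relay_field A b c) N C cbar"
  unfolding incrementally_exp_stable_def
  using \<open>cbar > 0\<close> relay_solutions_contract[OF \<open>is_norm N\<close> \<open>c \<noteq> 0\<close> assms(9,10)]
  by (intro conjI exI[of _ 1]) auto

end
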